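(* Let $\mathcal{G}$ be a subset of $\mathrm{S}_n(\mathbb{R}[\underline{x}])$ such that the set $K_{\mathcal{G}}$ is compact. Then for every $F \in \mathrm{S}_n(\mathbb{R}[\underline{x}])$ the following are equivalent: (1) For every $a \in \mathbb{R}^d$ and every nonzero positive semidefinite matrix $B \in \mathrm{S}_n(\mathbb{R})$ such that $\mathrm{Tr}(G(a)B) \ge 0$ for every $G \in \mathcal{G}$, we have $\mathrm{Tr}(F(a)B) > 0$. (2) There exists a real $\varepsilon > 0$ such that $F - \varepsilon I_n \in \mathrm{Pos}(K_{\mathcal{G}}) \cdot N_{\mathcal{G}}$.
   Context: $\mathbb{R}[\underline{x}] = \mathbb{R}[x_1,\ldots,x_d]$; $\sum \mathbb{R}[\underline{x}]^2$ is the set of all finite sums of squares of polynomials. $\mathrm{M}_n(\mathbb{R}[\underline{x}])$ is the algebra of $n\times n$ matrices over $\mathbb{R}[\underline{x}]$, $\mathrm{S}_n(\mathbb{R}[\underline{x}])$ (resp. $\mathrm{S}_n(\mathbb{R})$) is the space of symmetric $n \times n$ matrices over $\mathbb{R}[\underline{x}]$ (resp. $\mathbb{R}$), and $\sum \mathrm{M}_n(\mathbb{R}[\underline{x}])^2$ is the set of all finite sums of matrices $H^T H$ with $H \in \mathrm{M}_n(\mathbb{R}[\underline{x}])$. For $A \subseteq \mathbb{R}[\underline{x}]$ and $B \subseteq \mathrm{S}_n(\mathbb{R}[\underline{x}])$, $A \cdot B$ is the set of all finite sums $\sum_i a_i b_i$ with $a_i \in A$, $b_i \in B$. A subset $N \subseteq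 \mathrm{S}_n(\mathbb{R}[\underline{x}])$ is a weak quadratic module if $N + N \subseteq N$, $(\sum \mathbb{R}[\underline{x}]^2)\cdot N \subseteq N$ and $\sum \mathrm{M}_n(\mathbb{R}[\underline{x}])^2 \subseteq N$. $N_{\mathcal{G}}$ is the smallest weak quadratic module containing $\mathcal{G}$. $K_{\mathcal{G}}$ is the set of all $a \in \mathbb{R}^d$ for which there exists a nonzero positive semidefinite $B \in \mathrm{S}_n(\mathbb{R})$ with $\mathrm{Tr}(G(a)B) \ge 0$ for every $G \in \mathcal{G}$. For $K \subseteq \mathbb{R}^d$, $\mathrm{Pos}(K) = \{f \in \mathbb{R}[\underline{x}] : f(a) \ge 0 \text{ for all } a \in K\}$. *)

theory Defs
  imports "HOL-Analysis.Analysis" "HOL-Library.Poly_Mapping"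
begin

text \<open>
  Polynomials over the reals in variables indexed by the finite type \<open>'d\<close> (so the number
  of variables is \<open>CARD('d)\<close>), as finitely supported maps from exponent vectors to coefficients.
  The convolution product of \<open>HOL-Library.Poly_Mapping\<close> makes this a commutative ring.
\<close>

type_synonym 'd rpoly = "('d \<Rightarrow>\<^sub>0 nat) \<Rightarrow>\<^sub>0 real"

definition const_poly :: "real \<Rightarrow> 'd rpoly" where
  "const_poly c = Poly_Mapping.single 0 c"

definition eval_poly :: "'d::finite rpoly \<Rightarrow> real^'d \<Rightarrow> real" where
  "eval_poly p a =
     (\<Sum>m\<in>Poly_Mapping.keys p.
        Poly_Mapping.lookup p m * (\<Prod>i\<in>UNIV. (a $ i) ^ Poly_Mapping.lookup m i))"

definition eval_mat :: "'d::finite rpoly^'n^'n \<Rightarrow> real^'d \<Rightarrow> real^'n^'n" where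
  "eval_mat A a = map_matrix (\<lambda>p. eval_poly p a) A"

definition sym_matrices :: "('a^'n^'n) set" where
  "sym_matrices = {A. transpose A = A}"

definition pos_semidef :: "real^'n^'n \<Rightarrow> bool" where
  "pos_semidef B \<longleftrightarrow> B \<in> sym_matrices \<and> (\<forall>v. 0 \<le> v \<bullet> (B *v v))"

definition sos_polys :: "'d::finite rpoly set" where
  "sos_polys = {(\<Sum>i<k. (h i)\<^sup>2) | (k::nat) h. True}"

definition sos_matrices :: "('d::finite rpoly^'n^'n) set" where
  "sos_matrices = {(\<Sum>i<k. transpose (H i) ** H i) | (k::nat) (H :: nat \<Rightarrow> 'd rpoly^'n^'n). True}"

text \<open>All finite sums (the empty one included) of products of an element of \<open>A\<close> and one of \<open>B\<close>.\<close>

definition set_mult ::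
  "'d::finite rpoly set \<Rightarrow> ('d rpoly^'n^'n) set \<Rightarrow> ('d rpoly^'n^'n) set"  (infixl \<open>\<cdot>\<close> 70) where
  "A \<cdot> B = {(\<Sum>i<k. map_matrix (\<lambda>p. a i * p) (b i)) | (k::nat) a b.
              (\<forall>i<k. a i \<in> A) \<and> (\<forall>i<k. b i \<in> B)}"

definition weak_quadratic_module :: "('d::finite rpoly^'n^'n) set \<Rightarrow> bool" where
  "weak_quadratic_module N \<longleftrightarrow>
     N \<subseteq> sym_matrices \<and>
     (\<forall>A\<in>N. \<forall>B\<in>N. A + B \<in> N) \<and>
     sos_polys \<cdot> N \<subseteq> N \<and>
     sos_matrices \<subseteq> N"

definition wqm_generated ::
  "('d::finite rpoly^'n^'n) set \<Rightarrow> ('d rpoly^'n^'n) set" where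
  "wqm_generated \<G> = weak_quadratic_module hull \<G>"

definition K_set :: "('d::finite rpoly^'n^'n) set \<Rightarrow> (real^'d) set" where
  "K_set \<G> = {a. \<exists>B :: real^'n^'n. B \<noteq> 0 \<and> pos_semidef B \<and>
                    (\<forall>G\<in>\<G>. trace (eval_mat G a ** B) \<ge> 0)}"

definition Pos :: "(real^'d) set \<Rightarrow> 'd::finite rpoly set" where
  "Pos K = {f. \<forall>a\<in>K. eval_poly f a \<ge> 0}"

text \<open>
  The hull is an intersection of weak quadratic modules; for symmetric generators it is a
  nonempty intersection, and is itself the least weak quadratic module containing them.
\<close>

lemma transpose_sum_matrices:
  "transpose (\<Sum>i\<in>I. f i) = (\<Sum>i\<in>I. transpose (f i :: 'a::comm_monoid_add^'n^'m))"
  by (simp add: transpose_def vec_eq_iff)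

lemma weak_quadratic_module_sym_matrices:
  "weak_quadratic_module (sym_matrices :: ('d::finite rpoly^'n^'n) set)"
proof -
  have "A + B \<in> sym_matrices" if "A \<in> sym_matrices" "B \<in> sym_matrices"
    for A B :: "'d rpoly^'n^'n"
    using that by (simp add: sym_matrices_def transpose_def vec_eq_iff)
  moreover have "sos_polys \<cdot> (sym_matrices :: ('d rpoly^'n^'n) set) \<subseteq> sym_matrices"
    by (auto simp: set_mult_def sym_matrices_def transpose_def vec_eq_iff intro!: sum.cong)
  moreover have "(sos_matrices :: ('d rpoly^'n^'n) set) \<subseteq> sym_matrices"
    by (auto simp: sos_matrices_def sym_matrices_def transpose_sum_matrices matrix_transpose_mul)
  ultimately show ?thesis
    by (simp add: weak_quadratic_module_def)
qed

lemma weak_quadratic_module_wqm_generated: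
  assumes "\<G> \<subseteq> sym_matrices"
  shows "weak_quadratic_module (wqm_generated \<G>)"
proof -
  have mono: "A \<cdot> B \<subseteq> A \<cdot> C" if "B \<subseteq> C"
    for A :: "'a rpoly set" and B C :: "('a rpoly^'b^'b) set"
    using that unfolding set_mult_def by blast
  let ?N = "wqm_generated \<G>"
  have sub: "?N \<subseteq> M" if "weak_quadratic_module M" "\<G> \<subseteq> M" for M
    using that by (auto simp: wqm_generated_def hull_def)
  have "sos_polys \<cdot> ?N \<subseteq> M" if M: "weak_quadratic_module M" "\<G> \<subseteq> M" for M
    using mono[OF sub[OF M]] M(1) unfolding weak_quadratic_module_def by blast
  then have "sos_polys \<cdot> ?N \<subseteq> ?N"
    unfolding wqm_generated_def hull_def by blast
  moreover have "?N \<subseteq> sym_matrices"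
    using sub weak_quadratic_module_sym_matrices assms by blast
  moreover have "sos_matrices \<subseteq> ?N" "\<forall>A\<in>?N. \<forall>B\<in>?N. A + B \<in> ?N"
    by (auto simp: wqm_generated_def hull_def weak_quadratic_module_def)
  ultimately show ?thesis
    by (simp add: weak_quadratic_module_def)
qed

end

theory Submission
  imports Defs
begin

text \<open>The certificate direction holds because, for fixed \<open>a\<close> and \<open>B\<close>, the symmetric \<open>X\<close> with
  \<open>tr (X(a) B) \<ge> 0\<close> form a weak quadratic module. Conversely, compactness yields a uniform \<open>\<epsilon>\<close> such that
  \<open>F(a) - \<epsilon> I\<close> is positive on the dual of the cone \<open>{X(a) | X \<in> N}\<close>; by separation \<open>F - \<epsilon> I\<close> agrees at each
  \<open>a \<in> K\<close> with some member of \<open>N\<close>. A partition of unity on \<open>K\<close>, approximated by polynomials that are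
  nonnegative on \<open>K\<close>, glues these members to an element of \<open>Pos(K) \<cdot> N\<close> uniformly close to
  \<open>F - \<epsilon> I\<close>, and the small symmetric error is absorbed by \<open>(\<epsilon>/2) I\<close>.\<close>

section \<open>Evaluation\<close>

lemma eval_poly_superset:
  assumes "finite S" "Poly_Mapping.keys p \<subseteq> S"
  shows "eval_poly p a = (\<Sum>m\<in>S. Poly_Mapping.lookup p m * (\<Prod>i\<in>UNIV. (a $ i) ^ Poly_Mapping.lookup m i))"
  unfolding eval_poly_def
  by (rule sum.mono_neutral_left) (use assms in \<open>auto simp: in_keys_iff\<close>)

lemma eval_poly_single:
  "eval_poly (Poly_Mapping.single m c) a = c * (\<Prod>i\<in>UNIV. (a $ i) ^ Poly_Mapping.lookup m i)"
  by (subst eval_poly_superset[of "{m}"]) auto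

lemma eval_poly_const [simp]: "eval_poly (const_poly c) a = c"
  by (simp add: const_poly_def eval_poly_single)

lemma eval_poly_0 [simp]: "eval_poly 0 a = 0"
  by (simp add: eval_poly_def)

lemma eval_poly_1 [simp]: "eval_poly 1 a = 1"
  using eval_poly_const[of 1 a] by (simp add: const_poly_def)

lemma eval_poly_add [simp]: "eval_poly (p + q) a = eval_poly p a + eval_poly q a"
proof -
  let ?S = "Poly_Mapping.keys p \<union> Poly_Mapping.keys q"
  have "Poly_Mapping.keys (p + q) \<subseteq> ?S"
    by (rule keys_add)
  then show ?thesis
    by (simp add: eval_poly_superset[of ?S] lookup_add distrib_right sum.distrib)
qed

lemma eval_poly_uminus [simp]: "eval_poly (- p) a = - eval_poly p a"
  using eval_poly_add[of p "- p" a] by simp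

lemma eval_poly_diff [simp]: "eval_poly (p - q) a = eval_poly p a - eval_poly q a"
  using eval_poly_add[of p "- q" a] by simp

lemma eval_poly_sum [simp]: "eval_poly (\<Sum>i\<in>I. f i) a = (\<Sum>i\<in>I. eval_poly (f i) a)"
  by (induction I rule: infinite_finite_induct) auto

lemma poly_mapping_sum_singles:
  "(\<Sum>m\<in>Poly_Mapping.keys p. Poly_Mapping.single m (Poly_Mapping.lookup p m)) = p"
  by (rule poly_mapping_eqI) (auto simp: lookup_sum lookup_single when_def in_keys_iff)

lemma eval_poly_mult [simp]: "eval_poly (p * q) a = eval_poly p a * eval_poly q a"
proof -
  let ?s = "\<lambda>p m. Poly_Mapping.single m (Poly_Mapping.lookup p m)"
  have "p * q = (\<Sum>m\<in>Poly_Mapping.keys p. ?s p m) * (\<Sum>m\<in>Poly_Mapping.keys q. ?s q m)"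
    by (simp only: poly_mapping_sum_singles)
  also have "eval_poly \<dots> a =
      eval_poly (\<Sum>m\<in>Poly_Mapping.keys p. ?s p m) a * eval_poly (\<Sum>m\<in>Poly_Mapping.keys q. ?s q m) a"
    by (simp add: sum_product mult_single eval_poly_single lookup_add power_add prod.distrib algebra_simps)
  finally show ?thesis
    by (simp only: poly_mapping_sum_singles)
qed

lemma eval_poly_power [simp]: "eval_poly (p ^ k) a = eval_poly p a ^ k"
  by (induction k) auto

lemma continuous_on_eval_poly [continuous_intros]: "continuous_on S (eval_poly p)"
  unfolding eval_poly_def by (intro continuous_intros)

section \<open>Polynomial approximation on compact sets\<close>

lemma eval_poly_monomial_var:
  "eval_poly (Poly_Mapping.single (Poly_Mapping.single i 1) c) a = c * a $ i"
proof -
  have "(\<Prod>j\<in>UNIV. (a $ j) ^ Poly_Mapping.lookup (Poly_Mapping.single i 1) j)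
      = (\<Prod>j\<in>UNIV. if j = i then a $ i else 1)"
    by (intro prod.cong) (auto simp: lookup_single when_def)
  then show ?thesis
    by (simp add: eval_poly_single)
qed

text \<open>Bridge to Stone-Weierstrass, whose approximants are of type
  \<open>real_polynomial_function\<close>. The induction follows the generation of these functions;
  a linear one is a combination of coordinates by expansion in the standard basis.\<close>

lemma real_polynomial_function_eval_poly:
  fixes f :: "real^'d::finite \<Rightarrow> real"
  assumes "real_polynomial_function f"
  shows "\<exists>p. f = eval_poly p"
  using assms
proof induction
  case (linear f)
  interpret f: bounded_linear f by fact
  have "f x = eval_poly (\<Sum>i\<in>UNIV. Poly_Mapping.single (Poly_Mapping.single i 1) (f (axis i 1))) x" for x
  proof -
    have "f x = f (\<Sum>i\<in>UNIV. x $ i *\<^sub>R axis i 1)"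
      using basis_expansion[of x] by (simp add: scalar_mult_eq_scaleR)
    also have "\<dots> = (\<Sum>i\<in>UNIV. x $ i * f (axis i 1))"
      by (simp add: f.sum f.scaleR)
    finally show ?thesis
      by (simp only: eval_poly_sum eval_poly_monomial_var) (simp add: mult.commute)
  qed
  then show ?case by blast
next
  case (const c)
  have "(\<lambda>x. c) = eval_poly (const_poly c)" by auto
  then show ?case by blast
next
  case (add f g)
  then obtain p q where "f = eval_poly p" "g = eval_poly q" by blast
  then have "(\<lambda>x. f x + g x) = eval_poly (p + q)" by auto
  then show ?case by blast
next
  case (mult f g)
  then obtain p q where "f = eval_poly p" "g = eval_poly q" by blast
  then have "(\<lambda>x. f x * g x) = eval_poly (p * q)" by auto
  then show ?case by blast
qed

lemma eval_poly_approx: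
  fixes f :: "real^'d::finite \<Rightarrow> real"
  assumes "compact K" "continuous_on K f" "0 < e"
  obtains p where "\<And>x. x \<in> K \<Longrightarrow> \<bar>f x - eval_poly p x\<bar> < e"
  using Stone_Weierstrass_real_polynomial_function[OF assms] real_polynomial_function_eval_poly
  by metis

section \<open>Evaluation of polynomial matrices\<close>

lemma eval_mat_nth [simp]: "eval_mat A a $ i $ j = eval_poly (A $ i $ j) a"
  by (simp add: eval_mat_def)

lemma eval_mat_add [simp]: "eval_mat (A + B) a = eval_mat A a + eval_mat B a"
  by (simp add: vec_eq_iff)

lemma eval_mat_diff [simp]: "eval_mat (A - B) a = eval_mat A a - eval_mat B a"
  by (simp add: vec_eq_iff)

lemma eval_mat_sum [simp]: "eval_mat (\<Sum>i\<in>I. f i) a = (\<Sum>i\<in>I. eval_mat (f i) a)"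
  by (simp add: vec_eq_iff)

lemma eval_mat_scale [simp]:
  "eval_mat (map_matrix (\<lambda>q. p * q) A) a = eval_poly p a *\<^sub>R eval_mat A a"
  by (simp add: vec_eq_iff)

lemma eval_mat_mat [simp]: "eval_mat (mat p) a = mat (eval_poly p a)"
  by (simp add: vec_eq_iff mat_def)

lemma eval_mat_transpose: "eval_mat (transpose A) a = transpose (eval_mat A a)"
  by (simp add: vec_eq_iff transpose_def)

lemma eval_mat_mult: "eval_mat (A ** B) a = eval_mat A a ** eval_mat B a"
  by (simp add: vec_eq_iff matrix_matrix_mult_def)

lemma eval_mat_sym: "A \<in> sym_matrices \<Longrightarrow> eval_mat A a \<in> sym_matrices"
  by (metis (mono_tags) eval_mat_transpose mem_Collect_eq sym_matrices_def)

lemma continuous_on_eval_mat [continuous_intros]: "continuous_on S (eval_mat A)"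
  unfolding eval_mat_def map_matrix_def by (intro continuous_intros)

section \<open>Symmetric real matrices\<close>

text \<open>Turns the trace pairing into the Euclidean inner product on matrices, the form in which
  separating hyperplanes and Cauchy-Schwarz apply.\<close>

lemma trace_mult_sym:
  fixes A B :: "real^'n^'n"
  assumes "B \<in> sym_matrices"
  shows "trace (A ** B) = A \<bullet> B"
proof -
  have "B $ j $ i = B $ i $ j" for i j
    using assms by (auto simp: sym_matrices_def transpose_def vec_eq_iff)
  then show ?thesis
    by (simp add: trace_def matrix_matrix_mult_def inner_vec_def)
qed

text \<open>The rank-one matrix v v^T. The entry type is only required to have a product, so that
  one definition serves real and polynomial vectors alike.\<close>

definition outer :: "'a::times^'n \<Rightarrow> 'a^'n^'n" where
  "outer v = (\<chi> i j. v $ i * v $ j)"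

text \<open>Makes semidefiniteness of a symmetric B a family of linear conditions on B, one for each
  v.\<close>

lemma outer_inner:
  fixes B :: "real^'n^'n"
  shows "outer v \<bullet> B = v \<bullet> (B *v v)"
  by (simp add: outer_def inner_vec_def matrix_vector_mult_def sum_distrib_left algebra_simps)

text \<open>H^T H is the sum of the outer squares of the rows of H.\<close>

lemma transpose_mult_inner:
  fixes B H :: "real^'n^'n"
  shows "(transpose H ** H) \<bullet> B = (\<Sum>m\<in>UNIV. outer (H $ m) \<bullet> B)"
proof -
  have "transpose H ** H = (\<Sum>m\<in>UNIV. outer (H $ m))"
    by (simp add: vec_eq_iff matrix_matrix_mult_def transpose_def outer_def)
  then show ?thesis
    by (simp add: inner_sum_left)
qed

text \<open>Diagonal entries of B are nonnegative, so a vanishing trace kills the whole diagonal;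
  testing B on e_i + e_j and e_i - e_j then kills every other entry as well. This supplies the
  strict inequality in the certificate direction.\<close>

lemma pos_semidef_trace_pos:
  fixes B :: "real^'n^'n"
  assumes "pos_semidef B" "B \<noteq> 0"
  shows "mat 1 \<bullet> B > 0"
proof -
  have sym: "B $ j $ i = B $ i $ j" for i j
    using assms(1) by (auto simp: pos_semidef_def sym_matrices_def transpose_def vec_eq_iff)
  have psd: "outer v \<bullet> B \<ge> 0" for v
    using assms(1) by (simp add: pos_semidef_def outer_inner)
  have quad: "outer (s *\<^sub>R axis i 1 + t *\<^sub>R axis j 1) \<bullet> B = s\<^sup>2 * B$i$i + t\<^sup>2 * B$j$j + 2 * s * t * B$i$j"
    for i j s t
  proof -
    have B_axis: "axis k 1 \<bullet> (B *v axis l 1) = B$k$l" for k l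
      by (simp add: matrix_vector_mult_basis column_def inner_axis')
    show ?thesis
      unfolding outer_inner
      by (simp add: matrix_vector_right_distrib matrix_vector_mult_scaleR inner_add_left inner_add_right
          B_axis sym[of i j] power2_eq_square algebra_simps)
  qed
  have diag: "B$i$i \<ge> 0" for i
    using psd[of "1 *\<^sub>R axis i 1 + 0 *\<^sub>R axis i 1"] by (simp only: quad) simp
  have tr: "mat 1 \<bullet> B = (\<Sum>i\<in>UNIV. B$i$i)"
    by (simp add: inner_vec_def mat_def if_distrib if_distribR cong: if_cong)
  show ?thesis
  proof (rule ccontr)
    assume "\<not> ?thesis"
    then have "(\<Sum>i\<in>UNIV. B$i$i) = 0"
      using tr sum_nonneg[of UNIV "\<lambda>i. B$i$i"] diag by simp
    then have d0: "B$i$i = 0" for i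
      using diag sum_nonneg_eq_0_iff[of UNIV "\<lambda>i. B$i$i"] by auto
    have "B$i$j = 0" for i j
      using psd[of "1 *\<^sub>R axis i 1 + 1 *\<^sub>R axis j 1"] psd[of "1 *\<^sub>R axis i 1 + (-1) *\<^sub>R axis j 1"]
      unfolding quad d0 by simp
    then show False
      using assms(2) by (simp add: vec_eq_iff)
  qed
qed

text \<open>C is not assumed closed, so z is separated only weakly and may satisfy z . B = 0. The
  outer squares in C force the separating B to be semidefinite.\<close>

lemma sym_cone_separation:
  fixes C :: "(real^'n^'n) set"
  assumes add: "\<And>X Y. X \<in> C \<Longrightarrow> Y \<in> C \<Longrightarrow> X + Y \<in> C"
    and scale: "\<And>c X. 0 \<le> c \<Longrightarrow> X \<in> C \<Longrightarrow> c *\<^sub>R X \<in> C"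
    and sub: "C \<subseteq> sym_matrices" and out: "\<And>v. outer v \<in> C"
    and z: "z \<in> sym_matrices" "z \<notin> C"
  obtains B where "B \<noteq> 0" "pos_semidef B" "\<And>X. X \<in> C \<Longrightarrow> X \<bullet> B \<ge> 0" "z \<bullet> B \<le> 0"
proof -
  \<comment> \<open>Separating from \<open>C\<close> itself could return a skew matrix, which vanishes on all symmetric ones.
      The set \<open>D\<close> contains every skew matrix, which forces the functional to be symmetric.\<close>
  define D where "D = {X. X + transpose X \<in> C}"
  have tr_add: "transpose (X + Y) = transpose X + transpose Y" for X Y :: "real^'n^'n"
    by (simp add: vec_eq_iff transpose_def)
  have tr_scale: "transpose (c *\<^sub>R X) = c *\<^sub>R transpose X" for c and X :: "real^'n^'n"
    by (simp add: vec_eq_iff transpose_def)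
  have "0 \<in> C"
    using scale[OF order_refl out] by simp
  have symD: "X \<in> D \<longleftrightarrow> X \<in> C" if "X \<in> sym_matrices" for X
  proof -
    have "X + transpose X = 2 *\<^sub>R X"
      using that by (simp add: sym_matrices_def scaleR_2)
    then show ?thesis
      using scale[of 2 X] scale[of "1/2" "2 *\<^sub>R X"] by (auto simp: D_def)
  qed
  have D_add: "X + Y \<in> D" if "X \<in> D" "Y \<in> D" for X Y
    using add[of "X + transpose X" "Y + transpose Y"] that
    by (simp add: D_def tr_add algebra_simps)
  have D_scale: "c *\<^sub>R X \<in> D" if "0 \<le> c" "X \<in> D" for c X
    using scale[of c "X + transpose X"] that by (simp add: D_def tr_scale algebra_simps)
  have "convex D"
    unfolding convex_def by (auto intro: D_add D_scale)
  moreover have "0 \<in> D"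
    using \<open>0 \<in> C\<close> by (simp add: D_def transpose_def zero_vec_def[symmetric])
  moreover have "z \<notin> D"
    using z symD by blast
  ultimately obtain B b where B: "B \<noteq> 0" "B \<bullet> z \<le> b" "\<And>x. x \<in> D \<Longrightarrow> B \<bullet> x \<ge> b"
    using separating_hyperplane_sets[of "{z}" D] by auto
  have "b \<le> 0"
    using B(3)[OF \<open>0 \<in> D\<close>] by simp
  have nonneg: "B \<bullet> X \<ge> 0" if X: "X \<in> D" for X
  proof (rule ccontr)
    assume neg: "\<not> ?thesis"
    \<comment> \<open>A negative value on X could be scaled to exactly b - 1, below the bound b; the
      factor is nonnegative because b \<le> 0.\<close>
    have "B \<bullet> (((b - 1) / (B \<bullet> X)) *\<^sub>R X) \<ge> b"
      using neg \<open>b \<le> 0\<close> X by (intro B(3) D_scale) (auto intro: divide_nonpos_neg)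
    then show False
      using neg by simp
  qed
  have "B $ i $ j = B $ j $ i" for i j
  proof -
    define E :: "real^'n^'n" where "E = axis i (axis j 1) - axis j (axis i 1)"
    have "E + transpose E = 0" "- E + transpose (- E) = 0"
      by (auto simp: E_def vec_eq_iff transpose_def axis_def)
    then have "E \<in> D" "- E \<in> D"
      using \<open>0 \<in> C\<close> by (simp_all add: D_def)
    then have "B \<bullet> E = 0"
      using nonneg[of E] nonneg[of "- E"] by simp
    then show ?thesis
      by (simp add: E_def inner_diff_right inner_axis)
  qed
  then have "B \<in> sym_matrices"
    by (simp add: sym_matrices_def transpose_def vec_eq_iff)
  moreover have C_nonneg: "X \<bullet> B \<ge> 0" if "X \<in> C" for X
    using nonneg[of X] symD sub that by (auto simp: inner_commute)
  ultimately have "pos_semidef B"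
    using out by (metis outer_inner pos_semidef_def)
  then show ?thesis
    using that[of B] B(1,2) \<open>b \<le> 0\<close> C_nonneg by (simp add: inner_commute)
qed

section \<open>Weak quadratic modules\<close>

lemma set_mult_sumI:
  assumes "\<And>i. i < k \<Longrightarrow> a i \<in> A" "\<And>i. i < k \<Longrightarrow> b i \<in> B"
  shows "(\<Sum>i<(k::nat). map_matrix (\<lambda>p. a i * p) (b i)) \<in> A \<cdot> B"
  unfolding set_mult_def using assms by (intro CollectI exI conjI refl) auto

lemma set_multI: "a \<in> A \<Longrightarrow> b \<in> B \<Longrightarrow> map_matrix (\<lambda>p. a * p) b \<in> A \<cdot> B"
  using set_mult_sumI[of 1 "\<lambda>_. a" A "\<lambda>_. b" B] by simp

lemma set_mult_0: "0 \<in> A \<cdot> B"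
  using set_mult_sumI[of 0] by simp

text \<open>Concatenates two indexed families, since elements of \<open>A \<cdot> B\<close> are sums
  over an initial segment of the naturals.\<close>

lemma sum_lessThan_append:
  fixes k l :: nat
  shows "(\<Sum>i<k + l. if i < k then f i else g (i - k)) = (\<Sum>i<k. f i) + (\<Sum>i<l. g i)"
  by (induction l) (auto simp: add.assoc)

lemma set_mult_add:
  assumes "X \<in> A \<cdot> B" "Y \<in> A \<cdot> B"
  shows "X + Y \<in> A \<cdot> B"
proof -
  obtain k :: nat and a b where X: "X = (\<Sum>i<k. map_matrix (\<lambda>p. a i * p) (b i))"
    "\<forall>i<k. a i \<in> A" "\<forall>i<k. b i \<in> B"
    using assms(1) unfolding set_mult_def by blast
  obtain l :: nat and c d where Y: "Y = (\<Sum>i<l. map_matrix (\<lambda>p. c i * p) (d i))"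
    "\<forall>i<l. c i \<in> A" "\<forall>i<l. d i \<in> B"
    using assms(2) unfolding set_mult_def by blast
  let ?a = "\<lambda>i. if i < k then a i else c (i - k)" and ?b = "\<lambda>i. if i < k then b i else d (i - k)"
  have "X + Y = (\<Sum>i<k + l. if i < k then map_matrix (\<lambda>p. a i * p) (b i)
      else map_matrix (\<lambda>p. c (i - k) * p) (d (i - k)))"
    unfolding X(1) Y(1)
    by (rule sum_lessThan_append[of k _ "\<lambda>i. map_matrix (\<lambda>p. c i * p) (d i)", symmetric])
  also have "\<dots> = (\<Sum>i<k + l. map_matrix (\<lambda>p. ?a i * p) (?b i))"
    by (intro sum.cong) auto
  also have "\<dots> \<in> A \<cdot> B"
    using X(2,3) Y(2,3) by (intro set_mult_sumI) auto
  finally show ?thesis .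
qed

lemma set_mult_sum:
  assumes "\<And>i. i \<in> I \<Longrightarrow> f i \<in> A \<cdot> B"
  shows "(\<Sum>i\<in>I. f i) \<in> A \<cdot> B"
  using assms by (induction I rule: infinite_finite_induct) (auto simp: set_mult_0 set_mult_add)

lemma sos_poly_nonneg:
  assumes "p \<in> sos_polys"
  shows "eval_poly p a \<ge> 0"
  using assms by (auto simp: sos_polys_def sum_nonneg)

lemma const_poly_sos:
  assumes "0 \<le> c"
  shows "const_poly c \<in> sos_polys"
proof -
  have "const_poly c = (\<Sum>i<(1::nat). (const_poly (sqrt c))\<^sup>2)"
    using assms by (simp add: const_poly_def power2_eq_square mult_single)
  then show ?thesis
    unfolding sos_polys_def by (intro CollectI exI conjI) (assumption, rule TrueI)
qed

lemma outer_sos: "outer (v :: 'd::finite rpoly^'n) \<in> sos_matrices"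
proof -
  \<comment> \<open>Any row index works: H has v as row r and zeros elsewhere, so H^T H = v
    v^T.\<close>
  fix r :: 'n
  let ?H = "(\<chi> m. if m = r then v else 0) :: 'd rpoly^'n^'n"
  have "outer v $ k $ l = (transpose ?H ** ?H) $ k $ l" for k l
  proof -
    have "(transpose ?H ** ?H) $ k $ l = (\<Sum>m\<in>UNIV. if m = r then v $ k * v $ l else 0)"
      unfolding matrix_matrix_mult_def transpose_def vec_lambda_beta by (intro sum.cong) auto
    then show ?thesis
      by (simp add: outer_def)
  qed
  then have "outer v = (\<Sum>i<(1::nat). transpose ?H ** ?H)"
    by (simp add: vec_eq_iff)
  then show ?thesis
    unfolding sos_matrices_def by (intro CollectI exI conjI) (assumption, rule TrueI)
qed

lemma wqm_scale:
  assumes "weak_quadratic_module N" "X \<in> N" "0 \<le> c"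
  shows "map_matrix (\<lambda>p. const_poly c * p) X \<in> N"
  using assms set_multI[OF const_poly_sos] unfolding weak_quadratic_module_def by blast

lemma wqm_trace_nonneg:
  fixes \<G> :: "('d::finite rpoly^'n^'n) set"
  assumes "\<G> \<subseteq> sym_matrices" "pos_semidef B" "\<forall>G\<in>\<G>. trace (eval_mat G a ** B) \<ge> 0"
    and "X \<in> wqm_generated \<G>"
  shows "eval_mat X a \<bullet> B \<ge> 0"
proof -
  let ?M = "{X \<in> sym_matrices. eval_mat X a \<bullet> B \<ge> 0} :: ('d rpoly^'n^'n) set"
  have B: "B \<in> sym_matrices" "\<And>v. outer v \<bullet> B \<ge> 0"
    using assms(2) by (auto simp: pos_semidef_def outer_inner)
  have "eval_mat Y a \<bullet> B \<ge> 0" if "Y \<in> sos_polys \<cdot> ?M" for Y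
    using that unfolding set_mult_def
    by (auto simp: inner_sum_left intro!: sum_nonneg mult_nonneg_nonneg sos_poly_nonneg)
  moreover have "eval_mat Y a \<bullet> B \<ge> 0" if "Y \<in> sos_matrices" for Y :: "'d rpoly^'n^'n"
    using that unfolding sos_matrices_def
    by (auto simp: eval_mat_mult eval_mat_transpose inner_sum_left transpose_mult_inner B(2) intro!: sum_nonneg)
  \<comment> \<open>Symmetry of the products is inherited from the module of all symmetric matrices,
    so only the inequality had to be computed.\<close>
  moreover have "sos_polys \<cdot> ?M \<subseteq> sos_polys \<cdot> sym_matrices"
    unfolding set_mult_def by blast
  ultimately have "weak_quadratic_module ?M"
    using weak_quadratic_module_sym_matrices[where 'd='d and 'n='n]
    unfolding weak_quadratic_module_def by (auto simp: inner_add_left)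
  moreover have "\<G> \<subseteq> ?M"
    using assms(1,3) B(1) by (auto simp: trace_mult_sym)
  ultimately have "wqm_generated \<G> \<subseteq> ?M"
    unfolding wqm_generated_def by (intro hull_minimal)
  then show ?thesis
    using assms(4) by blast
qed

text \<open>The values at a of members of the module form a convex cone containing all outer
  squares. If z lay outside, the separating B would be admissible at a with z . B \<le> 0, against
  strict positivity; this is why exact interpolation is possible without closedness of the cone. At
  a point outside \<open>K_set \<G>\<close> no nonzero B is admissible, so every symmetric z is
  attained.\<close>

lemma wqm_interpolate:
  fixes \<G> :: "('d::finite rpoly^'n^'n) set"
  assumes "\<G> \<subseteq> sym_matrices" and z: "z \<in> sym_matrices"
    and pos: "\<And>B. B \<noteq> 0 \<Longrightarrow> pos_semidef B \<Longrightarrow> \<forall>G\<in>\<G>. trace (eval_mat G a ** B) \<ge> 0 \<Longrightarrow> z \<bullet> B > 0"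
  shows "\<exists>X\<in>wqm_generated \<G>. eval_mat X a = z"
proof (rule ccontr)
  assume none: "\<not> ?thesis"
  let ?N = "wqm_generated \<G>" and ?C = "(\<lambda>X. eval_mat X a) ` wqm_generated \<G>"
  note wqm = weak_quadratic_module_wqm_generated[OF assms(1)]
  have outC: "outer v \<in> ?C" for v
  proof -
    have "outer v = eval_mat (outer (\<chi> i. const_poly (v $ i))) a"
      by (simp add: vec_eq_iff outer_def)
    moreover have "outer (\<chi> i. const_poly (v $ i)) \<in> ?N"
      using outer_sos wqm unfolding weak_quadratic_module_def by blast
    ultimately show ?thesis by blast
  qed
  obtain B where B: "B \<noteq> 0" "pos_semidef B" "\<And>X. X \<in> ?C \<Longrightarrow> X \<bullet> B \<ge> 0" "z \<bullet> B \<le> 0"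
  proof (rule sym_cone_separation[of ?C z])
    show "X + Y \<in> ?C" if XY: "X \<in> ?C" "Y \<in> ?C" for X Y
    proof -
      obtain P Q where "P \<in> ?N" "Q \<in> ?N" "X = eval_mat P a" "Y = eval_mat Q a"
        using XY by blast
      then show ?thesis
        using wqm unfolding weak_quadratic_module_def by (metis eval_mat_add imageI)
    qed
    show "c *\<^sub>R X \<in> ?C" if cX: "0 \<le> c" "X \<in> ?C" for c X
    proof -
      obtain P where P: "P \<in> ?N" "X = eval_mat P a"
        using cX by blast
      then have "c *\<^sub>R X = eval_mat (map_matrix (\<lambda>p. const_poly c * p) P) a"
        by simp
      then show ?thesis
        using wqm_scale[OF wqm P(1) cX(1)] by blast
    qed
    show "?C \<subseteq> sym_matrices"
      using wqm unfolding weak_quadratic_module_def by (auto intro!: eval_mat_sym)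
    show "z \<notin> ?C"
      using none by blast
  qed (use z outC in auto)
  have "B \<in> sym_matrices"
    using B(2) by (simp add: pos_semidef_def)
  moreover have "\<G> \<subseteq> ?N"
    unfolding wqm_generated_def by (rule hull_subset)
  ultimately have "\<forall>G\<in>\<G>. trace (eval_mat G a ** B) \<ge> 0"
    using B(3) by (auto simp: trace_mult_sym)
  then show False
    using pos[of B] B by auto
qed

section \<open>Gluing over a compact set\<close>

lemma Pos_glue:
  fixes \<N> :: "('d::finite rpoly^'n^'n) set"
  assumes K: "compact K" and \<eta>: "0 < \<eta>"
    and interp: "\<And>a. a \<in> K \<Longrightarrow> \<exists>X\<in>\<N>. eval_mat X a = eval_mat T a"
  shows "\<exists>S \<in> Pos K \<cdot> \<N>. \<forall>x\<in>K. norm (eval_mat T x - eval_mat S x) \<le> \<eta>"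
proof -
  obtain N where N: "\<And>a. a \<in> K \<Longrightarrow> N a \<in> \<N>" "\<And>a. a \<in> K \<Longrightarrow> eval_mat (N a) a = eval_mat T a"
    using interp by metis
  \<comment> \<open>A bump that is positive exactly where N a approximates T to better than
    \<eta>/2, in particular at a itself, where the two agree.\<close>
  define \<phi> where "\<phi> a x = max 0 (\<eta>/2 - norm (eval_mat T x - eval_mat (N a) x))" for a x
  have cont_\<phi>: "continuous_on S (\<phi> a)" for S a
    unfolding \<phi>_def by (intro continuous_intros)
  have "open {x. \<phi> a x > 0}" for a
    using open_Collect_less[OF continuous_on_const cont_\<phi>] .
  moreover have "K \<subseteq> (\<Union>a\<in>K. {x. \<phi> a x > 0})"
    using N(2) \<eta> by (auto simp: \<phi>_def)
  ultimately obtain A where A: "A \<subseteq> K" "finite A" "K \<subseteq> (\<Union>a\<in>A. {x. \<phi> a x > 0})"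
    using compactE_image[OF K] by metis
  define \<Phi> where "\<Phi> x = (\<Sum>a\<in>A. \<phi> a x)" for x
  have \<phi>_nonneg: "\<phi> a x \<ge> 0" for a x
    by (simp add: \<phi>_def)
  have \<Phi>_pos: "\<Phi> x > 0" if x: "x \<in> K" for x
  proof -
    obtain a where a: "a \<in> A" "\<phi> a x > 0"
      using A(3) x by blast
    then show ?thesis
      unfolding \<Phi>_def using \<phi>_nonneg A(2) by (intro sum_pos2) auto
  qed
  define \<psi> where "\<psi> a x = \<phi> a x / \<Phi> x" for a x
  have \<psi>_nonneg: "\<psi> a x \<ge> 0" if "x \<in> K" for a x
    using \<phi>_nonneg \<Phi>_pos[OF that] by (simp add: \<psi>_def)
  have \<psi>_sum: "(\<Sum>a\<in>A. \<psi> a x) = 1" if "x \<in> K" for x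
    using \<Phi>_pos[OF that] by (simp add: \<psi>_def sum_divide_distrib[symmetric] \<Phi>_def[symmetric])
  have cont_\<psi>: "continuous_on K (\<psi> a)" for a
    unfolding \<psi>_def \<Phi>_def
    by (intro continuous_intros cont_\<phi>) (use \<Phi>_pos in \<open>fastforce simp: \<Phi>_def\<close>)
  have "\<exists>L>0. \<forall>x\<in>K. norm (eval_mat (N a) x) \<le> L" for a
    using compact_imp_bounded[OF compact_continuous_image[OF continuous_on_eval_mat K, of "N a"]]
    by (auto simp: bounded_pos)
  then obtain L where L: "\<And>a. L a > 0" "\<And>a x. x \<in> K \<Longrightarrow> norm (eval_mat (N a) x) \<le> L a"
    by metis
  \<comment> \<open>The summand 1 keeps \<Lambda> positive even when A is empty.\<close>
  define \<Lambda> where "\<Lambda> = 1 + (\<Sum>a\<in>A. L a)"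
  have \<Lambda>: "\<Lambda> > 0" "(\<Sum>a\<in>A. L a) \<le> \<Lambda>"
    using sum_nonneg[of A L] L(1) unfolding \<Lambda>_def by (auto simp: less_imp_le intro: add_pos_nonneg)
  define \<delta> where "\<delta> = \<eta> / (4 * \<Lambda>)"
  have "\<delta> > 0"
    using \<Lambda> \<eta> by (simp add: \<delta>_def)
  \<comment> \<open>Approximating the shifted weight \<psi> + \<delta> within \<delta> puts p
    strictly between \<psi> and \<psi> + 2\<delta> on K: hence p is nonnegative there, and its error
    against \<psi> is at most 2\<delta>. Weighted by the bounds L, these errors total at most
    2\<delta>\<Lambda> = \<eta>/2.\<close>
  have "\<exists>p. \<forall>x\<in>K. \<bar>(\<psi> a x + \<delta>) - eval_poly p x\<bar> < \<delta>" for a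
    using eval_poly_approx[OF K continuous_on_add[OF cont_\<psi> continuous_on_const] \<open>\<delta> > 0\<close>, of a \<delta>]
    by metis
  then obtain p where p: "\<And>a x. x \<in> K \<Longrightarrow> \<bar>(\<psi> a x + \<delta>) - eval_poly (p a) x\<bar> < \<delta>"
    by metis
  let ?S = "\<Sum>a\<in>A. map_matrix (\<lambda>q. p a * q) (N a)"
  have "p a \<in> Pos K" for a
    unfolding Pos_def using p[of _ a] \<psi>_nonneg[of _ a] by force
  then have "?S \<in> Pos K \<cdot> \<N>"
    using N(1) A(1) by (intro set_mult_sum set_multI) auto
  moreover have "norm (eval_mat T x - eval_mat ?S x) \<le> \<eta>" if x: "x \<in> K" for x
  proof -
    let ?T = "eval_mat T x" and ?N = "\<lambda>a. eval_mat (N a) x"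
    let ?E = "\<lambda>a. \<psi> a x *\<^sub>R (?T - ?N a)" and ?R = "\<lambda>a. (\<psi> a x - eval_poly (p a) x) *\<^sub>R ?N a"
    have "?T = (\<Sum>a\<in>A. \<psi> a x *\<^sub>R ?T)"
      by (simp add: scaleR_sum_left[symmetric] \<psi>_sum[OF x])
    then have "?T - eval_mat ?S x = (\<Sum>a\<in>A. \<psi> a x *\<^sub>R ?T) - (\<Sum>a\<in>A. eval_poly (p a) x *\<^sub>R ?N a)"
      by simp
    \<comment> \<open>\<open>?E\<close> is the local error, averaged by the exact partition of
      unity, which charges N a only where it is \<eta>/2-close to T; \<open>?R\<close> is the error
      from replacing the weights by polynomials. Each part gets half of \<eta>.\<close>
    also have "\<dots> = (\<Sum>a\<in>A. ?E a) + (\<Sum>a\<in>A. ?R a)"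
      by (simp add: sum_subtractf[symmetric] sum.distrib[symmetric] algebra_simps)
    finally have "norm (?T - eval_mat ?S x) \<le> norm (\<Sum>a\<in>A. ?E a) + norm (\<Sum>a\<in>A. ?R a)"
      by (simp add: norm_triangle_ineq)
    also have "norm (\<Sum>a\<in>A. ?E a) \<le> (\<Sum>a\<in>A. \<psi> a x * (\<eta>/2))"
    proof (rule sum_norm_le)
      fix a
      have "\<psi> a x = 0 \<or> norm (?T - ?N a) \<le> \<eta>/2"
        by (auto simp: \<psi>_def \<phi>_def max_def)
      then show "norm (?E a) \<le> \<psi> a x * (\<eta>/2)"
        using mult_left_mono[OF _ \<psi>_nonneg[OF x, of a]] \<psi>_nonneg[OF x, of a] by fastforce
    qed
    also have "\<dots> = \<eta>/2"
      unfolding sum_distrib_right[symmetric] \<psi>_sum[OF x] by simp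
    also have "norm (\<Sum>a\<in>A. ?R a) \<le> (\<Sum>a\<in>A. (2 * \<delta>) * L a)"
    proof (rule sum_norm_le)
      fix a
      have "\<bar>\<psi> a x - eval_poly (p a) x\<bar> \<le> 2 * \<delta>"
        using p[OF x, of a] by linarith
      then show "norm (?R a) \<le> (2 * \<delta>) * L a"
        using L(2)[OF x, of a] by (simp add: mult_mono)
    qed
    also have "\<dots> = 2 * \<delta> * (\<Sum>a\<in>A. L a)"
      by (simp add: sum_distrib_left)
    also have "\<dots> \<le> 2 * \<delta> * \<Lambda>"
      using \<Lambda> \<open>\<delta> > 0\<close> by (intro mult_left_mono) auto
    also have "\<dots> = \<eta>/2"
      using \<Lambda> by (simp add: \<delta>_def)
    finally show ?thesis by simp
  qed
  ultimately show ?thesis by blast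
qed

section \<open>Absorbing small symmetric matrices\<close>

lemma map_matrix_mult_nth_outer:
  "map_matrix (\<lambda>q. p * q) (outer v) $ k $ l = p * (v $ k * v $ l)"
  by (simp add: outer_def)

text \<open>A symmetric matrix with small entries is absorbed by the identity, with weights that are
  affine in its entries: \<open>\<plusminus>(E\<^sub>i\<^sub>j + E\<^sub>j\<^sub>i) + E\<^sub>i\<^sub>i + E\<^sub>j\<^sub>j\<close> is the outer square of \<open>e\<^sub>i \<plusminus> e\<^sub>j\<close>.\<close>

lemma small_sym_absorbed:
  fixes M :: "'d::finite rpoly^'n^'n"
  assumes M: "M \<in> sym_matrices" and small: "\<And>x i j. x \<in> K \<Longrightarrow> \<bar>eval_poly (M $ i $ j) x\<bar> \<le> \<eta>"
    and out: "\<And>v. outer v \<in> \<N>"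
  shows "M + mat (const_poly (real CARD('n) * \<eta>)) \<in> Pos K \<cdot> \<N>"
proof -
  \<comment> \<open>The sum runs over all ordered pairs, diagonal ones included. There
    \<open>polarize\<close> yields a factor 2q, and both M and n h I arise twice by exchanging i and
    j; q = 1/4 makes the total exactly M + n h I.\<close>
  define q h :: "'d rpoly" where "q = const_poly (1/4)" and "h = const_poly \<eta>"
  have sym: "M $ j $ i = M $ i $ j" for i j
    using M by (auto simp: sym_matrices_def transpose_def vec_eq_iff)
  let ?P = "\<lambda>i j. map_matrix (\<lambda>p. (q * (h + M $ i $ j)) * p) (outer (axis i 1 + axis j 1))"
  let ?Q = "\<lambda>i j. map_matrix (\<lambda>p. (q * (h - M $ i $ j)) * p) (outer (axis i 1 - axis j 1))"
  have "q * (h + M $ i $ j) \<in> Pos K" "q * (h - M $ i $ j) \<in> Pos K" for i j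
    using small[of _ i j] by (fastforce simp: Pos_def q_def h_def abs_le_iff)+
  then have mem: "(\<Sum>i\<in>UNIV. \<Sum>j\<in>UNIV. ?P i j + ?Q i j) \<in> Pos K \<cdot> \<N>"
    by (intro set_mult_sum set_mult_add set_multI out)
  have q4: "q + q + q + q = 1"
    by (simp add: q_def const_poly_def flip: single_add)
  have polarize: "q * (h + m) * ((s + t) * (s' + t')) + q * (h - m) * ((s - t) * (s' - t'))
      = (q + q) * (h * s * s' + h * t * t' + m * s * t' + m * t * s')" for m s t s' t'
    by (simp add: algebra_simps)
  let ?d = "\<lambda>i k. if i = k then 1 else 0 :: 'd rpoly"
  have d_mult: "x * ?d i k = (if i = k then x else 0)" for x and i k :: 'n
    by simp
  have "(\<Sum>i\<in>UNIV. \<Sum>j\<in>UNIV. ?P i j + ?Q i j) $ k $ l = (M + mat (const_poly (real CARD('n) * \<eta>))) $ k $ l" for k l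
  proof -
    have "(?P i j + ?Q i j) $ k $ l = (q + q) * (h * ?d i k * ?d i l + h * ?d j k * ?d j l
        + M $ i $ j * ?d i k * ?d j l + M $ i $ j * ?d j k * ?d i l)" for i j
    proof -
      have ax: "(axis i 1 :: 'd rpoly^'n) $ k = ?d i k" for i k
        by (simp add: axis_def eq_commute)
      show ?thesis
        by (simp only: vector_add_component map_matrix_mult_nth_outer vector_minus_component ax polarize)
    qed
    then have "(\<Sum>i\<in>UNIV. \<Sum>j\<in>UNIV. ?P i j + ?Q i j) $ k $ l
      = (\<Sum>i\<in>UNIV. \<Sum>j\<in>UNIV. (q + q) * (h * ?d i k * ?d i l + h * ?d j k * ?d j l
          + M $ i $ j * ?d i k * ?d j l + M $ i $ j * ?d j k * ?d i l))"
      by (simp only: sum_component)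
    also have "\<dots> = (q + q) * ((\<Sum>i\<in>UNIV. \<Sum>j\<in>(UNIV::'n set). h * ?d i k * ?d i l)
          + (\<Sum>i\<in>(UNIV::'n set). \<Sum>j\<in>UNIV. h * ?d j k * ?d j l)
          + (\<Sum>i\<in>UNIV. \<Sum>j\<in>UNIV. M $ i $ j * ?d i k * ?d j l)
          + (\<Sum>i\<in>UNIV. \<Sum>j\<in>UNIV. M $ i $ j * ?d j k * ?d i l))"
      by (simp only: sum.distrib sum_distrib_left distrib_left)
    also have "(\<Sum>i\<in>UNIV. \<Sum>j\<in>(UNIV::'n set). h * ?d i k * ?d i l) = of_nat CARD('n) * h * ?d k l"
      by (subst sum.swap) (auto simp: d_mult)
    also have "(\<Sum>i\<in>(UNIV::'n set). \<Sum>j\<in>UNIV. h * ?d j k * ?d j l) = of_nat CARD('n) * h * ?d k l"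
      by (auto simp: d_mult)
    also have "(\<Sum>i\<in>UNIV. \<Sum>j\<in>UNIV. M $ i $ j * ?d i k * ?d j l) = M $ k $ l"
      by (simp add: d_mult)
    also have "(\<Sum>i\<in>UNIV. \<Sum>j\<in>UNIV. M $ i $ j * ?d j k * ?d i l) = M $ k $ l"
      by (subst sum.swap) (simp add: d_mult sym[of k l])
    also have "(q + q) * (of_nat CARD('n) * h * ?d k l + of_nat CARD('n) * h * ?d k l + M $ k $ l + M $ k $ l)
        = (q + q + q + q) * (of_nat CARD('n) * h * ?d k l + M $ k $ l)"
      by (simp only: distrib_left distrib_right ac_simps)
    also have "of_nat CARD('n) * h = const_poly (real CARD('n) * \<eta>)"
      by (simp add: h_def const_poly_def mult_single flip: single_of_nat)
    also note q4
    finally show ?thesis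
      by (simp only: vector_add_component mat_def vec_lambda_beta) auto
  qed
  then have "(\<Sum>i\<in>UNIV. \<Sum>j\<in>UNIV. ?P i j + ?Q i j) = M + mat (const_poly (real CARD('n) * \<eta>))"
    by (simp only: vec_eq_iff) blast
  then show ?thesis
    using mem by simp
qed

section \<open>The equivalence\<close>

text \<open>Pairs (a, B) with a in the compact set and B admissible of norm 1 form a compact set, on
  which the trace of F(a) B attains a positive minimum. Homogeneity in B extends the bound to all
  admissible B.\<close>

lemma uniform_trace_bound:
  fixes \<G> :: "('d::finite rpoly^'n^'n) set"
  assumes K: "compact (K_set \<G>)"
    and pos: "\<And>a B. B \<noteq> 0 \<Longrightarrow> pos_semidef B \<Longrightarrow> \<forall>G\<in>\<G>. trace (eval_mat G a ** B) \<ge> 0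
                \<Longrightarrow> trace (eval_mat F a ** B) > 0"
  obtains \<epsilon> where "\<epsilon> > 0"
    "\<And>a B. B \<noteq> 0 \<Longrightarrow> pos_semidef B \<Longrightarrow> \<forall>G\<in>\<G>. trace (eval_mat G a ** B) \<ge> 0
      \<Longrightarrow> (eval_mat F a - mat \<epsilon>) \<bullet> B > 0"
proof -
  let ?dual = "\<lambda>a B. pos_semidef B \<and> (\<forall>G\<in>\<G>. trace (eval_mat G a ** B) \<ge> 0)"
  define Z where "Z = {(a, B). a \<in> K_set \<G> \<and> norm B = 1 \<and> ?dual a B}"
  \<comment> \<open>Exhibits Z as a compact product cut by closed conditions: equalities and weak
    inequalities between continuous functions of the pair.\<close>
  have eq: "Z = (K_set \<G> \<times> sphere 0 1) \<inter>
      ((\<Inter>i. \<Inter>j. {ab. snd ab $ i $ j = snd ab $ j $ i}) \<inter> (\<Inter>v. {ab. outer v \<bullet> snd ab \<ge> 0}) \<inter>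
       (\<Inter>G\<in>\<G>. {ab. eval_mat G (fst ab) \<bullet> snd ab \<ge> 0}))"
  proof -
    have "B \<in> sym_matrices \<longleftrightarrow> (\<forall>i j. B $ i $ j = B $ j $ i)" for B :: "real^'n^'n"
      by (auto simp: sym_matrices_def transpose_def vec_eq_iff)
    then show ?thesis
      by (auto simp: Z_def pos_semidef_def outer_inner trace_mult_sym)
  qed
  have cont: "continuous_on UNIV (\<lambda>ab :: (real^'d) \<times> (real^'n^'n). eval_mat G (fst ab) \<bullet> snd ab)" for G
    by (intro continuous_intros continuous_on_compose2[OF continuous_on_eval_mat[of UNIV]]) auto
  have "compact Z"
    unfolding eq
    by (intro compact_Int_closed compact_Times K compact_sphere closed_Int closed_INT ballI
        closed_Collect_eq closed_Collect_le cont continuous_intros)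
  have posZ: "eval_mat F (fst ab) \<bullet> snd ab > 0" if "ab \<in> Z" for ab
  proof -
    have "snd ab \<noteq> 0"
      using that by (auto simp: Z_def)
    then show ?thesis
      using that pos[of "snd ab" "fst ab"] trace_mult_sym[of "snd ab"]
      by (auto simp: Z_def pos_semidef_def)
  qed
  obtain m where m: "m > 0" "\<And>ab. ab \<in> Z \<Longrightarrow> eval_mat F (fst ab) \<bullet> snd ab \<ge> m"
  proof (cases "Z = {}")
    case True
    then show ?thesis using that[of 1] by simp
  next
    case False
    then obtain ab0 where "ab0 \<in> Z" "\<And>ab. ab \<in> Z \<Longrightarrow>
        eval_mat F (fst ab0) \<bullet> snd ab0 \<le> eval_mat F (fst ab) \<bullet> snd ab"
      using continuous_attains_inf[OF \<open>compact Z\<close> False continuous_on_subset[OF cont]] by blast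
    then show ?thesis using that posZ by blast
  qed
  \<comment> \<open>On unit B, Cauchy-Schwarz bounds \<epsilon> I . B by \<epsilon> times the norm
    of I; the 1 in the denominator makes this strictly less than m.\<close>
  define \<epsilon> where "\<epsilon> = m / (1 + norm (mat 1 :: real^'n^'n))"
  have \<epsilon>: "\<epsilon> > 0" "\<epsilon> * norm (mat 1 :: real^'n^'n) < m"
    using m(1) by (auto simp: \<epsilon>_def field_simps add_pos_nonneg)
  have mat_eq: "mat \<epsilon> = \<epsilon> *\<^sub>R (mat 1 :: real^'n^'n)"
    by (simp add: vec_eq_iff mat_def)
  have "(eval_mat F a - mat \<epsilon>) \<bullet> B > 0"
    if B: "B \<noteq> 0" "pos_semidef B" "\<forall>G\<in>\<G>. trace (eval_mat G a ** B) \<ge> 0" for a B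
  proof -
    define B' where "B' = (1 / norm B) *\<^sub>R B"
    have "norm B' = 1"
      using B(1) by (simp add: B'_def)
    have symB: "B \<in> sym_matrices"
      using B(2) by (simp add: pos_semidef_def)
    then have symB': "B' \<in> sym_matrices"
      by (auto simp: B'_def sym_matrices_def transpose_def vec_eq_iff)
    have "pos_semidef B'"
      using B(2) symB' by (simp add: pos_semidef_def B'_def flip: outer_inner)
    moreover have "\<forall>G\<in>\<G>. trace (eval_mat G a ** B') \<ge> 0"
      using B(3) trace_mult_sym[OF symB] trace_mult_sym[OF symB'] by (simp add: B'_def)
    moreover have "a \<in> K_set \<G>"
      unfolding K_set_def using B by blast
    ultimately have "(a, B') \<in> Z"
      using \<open>norm B' = 1\<close> by (simp add: Z_def)
    then have "eval_mat F a \<bullet> B' \<ge> m"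
      using m(2) by fastforce
    moreover have "mat 1 \<bullet> B' \<le> norm (mat 1 :: real^'n^'n)"
      using norm_cauchy_schwarz[of "mat 1" B'] \<open>norm B' = 1\<close> by simp
    then have "\<epsilon> * (mat 1 \<bullet> B') \<le> \<epsilon> * norm (mat 1 :: real^'n^'n)"
      using \<epsilon>(1) by simp
    ultimately have "(eval_mat F a - mat \<epsilon>) \<bullet> B' > 0"
      using \<epsilon>(2) by (simp add: mat_eq inner_diff_left)
    then have "(1 / norm B) * ((eval_mat F a - mat \<epsilon>) \<bullet> B) > 0"
      by (simp add: B'_def)
    then show ?thesis
      using B(1) by (simp only: zero_less_mult_iff) simp
  qed
  then show ?thesis
    using that \<epsilon>(1) by blast
qed

theorem theorem6p2:
  fixes \<G> :: "('d::finite rpoly^'n^'n) set" and F :: "'d rpoly^'n^'n"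
  assumes "\<G> \<subseteq> sym_matrices"
    and "compact (K_set \<G>)"
    and "F \<in> sym_matrices"
  shows "(\<forall>(a :: real^'d) (B :: real^'n^'n).
            B \<noteq> 0 \<and> pos_semidef B \<and> (\<forall>G\<in>\<G>. trace (eval_mat G a ** B) \<ge> 0)
              \<longrightarrow> trace (eval_mat F a ** B) > 0)
         \<longleftrightarrow>
         (\<exists>\<epsilon>>0. F - mat (const_poly \<epsilon>) \<in> Pos (K_set \<G>) \<cdot> wqm_generated \<G>)"
    (is "?pos \<longleftrightarrow> ?cert")
proof
  let ?K = "K_set \<G>" and ?N = "wqm_generated \<G>"
  note wqm = weak_quadratic_module_wqm_generated[OF assms(1)]
  assume ?pos
  then obtain \<epsilon> where \<epsilon>: "\<epsilon> > 0"
    "\<And>a B. B \<noteq> 0 \<Longrightarrow> pos_semidef B \<Longrightarrow> \<forall>G\<in>\<G>. trace (eval_mat G a ** B) \<ge> 0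
      \<Longrightarrow> (eval_mat F a - mat \<epsilon>) \<bullet> B > 0"
    using uniform_trace_bound[OF assms(2), of F] by blast
  \<comment> \<open>Absorbing an error with entries of size \<eta> costs n \<eta> I, here half of
    \<epsilon> I; the other half survives as the margin of the certificate.\<close>
  define \<eta> where "\<eta> = \<epsilon> / (2 * real CARD('n))"
  have \<eta>: "\<eta> > 0" "real CARD('n) * \<eta> = \<epsilon> / 2"
    using \<epsilon>(1) by (simp_all add: \<eta>_def)
  let ?T = "F - mat (const_poly \<epsilon>)"
  have symT: "?T \<in> sym_matrices"
    using assms(3) by (auto simp: sym_matrices_def transpose_def vec_eq_iff mat_def)
  have "\<exists>X\<in>?N. eval_mat X a = eval_mat ?T a" for a
    using \<epsilon>(2) by (intro wqm_interpolate[OF assms(1) eval_mat_sym[OF symT]]) simp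
  then obtain S where S: "S \<in> Pos ?K \<cdot> ?N" "\<And>x. x \<in> ?K \<Longrightarrow> norm (eval_mat ?T x - eval_mat S x) \<le> \<eta>"
    using Pos_glue[OF assms(2) \<eta>(1)] by blast
  have "S \<in> sym_matrices"
  proof -
    have "X \<in> sym_matrices" if "X \<in> ?N" for X
      using wqm that unfolding weak_quadratic_module_def by blast
    then show ?thesis
      using S(1) by (fastforce simp: set_mult_def sym_matrices_def transpose_def vec_eq_iff intro!: sum.cong)
  qed
  then have "?T - S \<in> sym_matrices"
    using symT by (simp add: sym_matrices_def transpose_def vec_eq_iff)
  moreover have "\<bar>eval_poly ((?T - S) $ i $ j) x\<bar> \<le> \<eta>" if "x \<in> ?K" for x i j
  proof -
    have "\<bar>(eval_mat (?T - S) x) $ i $ j\<bar> \<le> norm (eval_mat (?T - S) x)"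
      using Finite_Cartesian_Product.norm_nth_le[of "eval_mat (?T - S) x $ i" j]
        Finite_Cartesian_Product.norm_nth_le[of "eval_mat (?T - S) x" i]
      unfolding real_norm_def by (rule order_trans)
    also have "\<dots> \<le> \<eta>"
      using S(2)[OF that] by (simp only: eval_mat_diff)
    finally show ?thesis
      by (simp only: eval_mat_nth)
  qed
  moreover have "outer v \<in> ?N" for v
    using outer_sos wqm unfolding weak_quadratic_module_def by blast
  ultimately have "(?T - S) + mat (const_poly (\<epsilon> / 2)) \<in> Pos ?K \<cdot> ?N"
    using small_sym_absorbed[of "?T - S" ?K \<eta> ?N] \<eta>(2) by simp
  then have "S + ((?T - S) + mat (const_poly (\<epsilon> / 2))) \<in> Pos ?K \<cdot> ?N"
    by (rule set_mult_add[OF S(1)])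
  moreover have "const_poly \<epsilon> = const_poly (\<epsilon> / 2) + (const_poly (\<epsilon> / 2) :: 'd rpoly)"
    by (simp add: const_poly_def flip: single_add)
  \<comment> \<open>The approximant and the absorbed error recombine exactly, so the certificate
    holds with \<epsilon>/2.\<close>
  then have "S + ((?T - S) + mat (const_poly (\<epsilon> / 2))) = F - mat (const_poly (\<epsilon> / 2))"
    by (simp add: vec_eq_iff mat_def)
  ultimately show ?cert
    using \<epsilon>(1) by (intro exI[of _ "\<epsilon> / 2"]) simp
next
  let ?K = "K_set \<G>" and ?N = "wqm_generated \<G>"
  assume ?cert
  then obtain \<epsilon> and k :: nat and p X where \<epsilon>: "\<epsilon> > 0"
    and eq: "F - mat (const_poly \<epsilon>) = (\<Sum>i<k. map_matrix (\<lambda>q. p i * q) (X i))"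
    and pX: "\<forall>i<k. p i \<in> Pos ?K" "\<forall>i<k. X i \<in> ?N"
    unfolding set_mult_def by blast
  show ?pos
  proof (intro allI impI, elim conjE)
    fix a :: "real^'d" and B :: "real^'n^'n"
    assume B: "B \<noteq> 0" "pos_semidef B" "\<forall>G\<in>\<G>. trace (eval_mat G a ** B) \<ge> 0"
    then have a: "a \<in> ?K"
      unfolding K_set_def by blast
    \<comment> \<open>At a point of K the weights p i are nonnegative numbers, so pairing the
      certificate with B leaves F(a) . B at least \<epsilon> times the trace of B, which is
      positive.\<close>
    have "eval_mat F a - mat \<epsilon> = (\<Sum>i<k. eval_poly (p i) a *\<^sub>R eval_mat (X i) a)"
      using arg_cong[OF eq, of "\<lambda>A. eval_mat A a"] by simp
    moreover have "(\<Sum>i<k. eval_poly (p i) a *\<^sub>R eval_mat (X i) a) \<bullet> B \<ge> 0"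
      using pX a wqm_trace_nonneg[OF assms(1) B(2,3)]
      by (auto simp: inner_sum_left Pos_def intro!: sum_nonneg)
    ultimately have "eval_mat F a \<bullet> B \<ge> mat \<epsilon> \<bullet> B"
      by (metis diff_ge_0_iff_ge inner_diff_left)
    moreover have "mat \<epsilon> = \<epsilon> *\<^sub>R (mat 1 :: real^'n^'n)"
      by (simp add: vec_eq_iff mat_def)
    ultimately have "eval_mat F a \<bullet> B > 0"
      using pos_semidef_trace_pos[OF B(2,1)] \<epsilon> by (smt (verit) inner_scaleR_left mult_pos_pos)
    then show "trace (eval_mat F a ** B) > 0"
      using B(2) by (simp add: pos_semidef_def trace_mult_sym)
  qed
qed

end
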